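(* Let $V$ and $H$ be complex Hilbert spaces, let $\mathfrak{a} \colon V \times V \to \mathbb{C}$ be a symmetric continuous sesquilinear form and let $j \in \mathcal{L}(V,H)$. Let $A$ be the graph associated with $(\mathfrak{a},j)$. If $\mathfrak{a}$ is compactly elliptic, then $A$ is a self-adjoint graph.
   Context: Sesquilinear forms are linear in the first and antilinear in the second variable, and $\mathfrak{a}(u) := \mathfrak{a}(u,u)$. $\mathcal{L}(X,Y)$ denotes the bounded linear operators from $X$ to $Y$. The form $\mathfrak{a}$ is called compactly elliptic if there exist a Hilbert space $\widetilde{H}$, a compact $\tilde{j} \in \mathcal{L}(V,\widetilde{H})$, $\omega \in \mathbb{R}$ and $\mu > 0$ such that $\mathrm{Re}\, \mathfrak{a}(u) + \omega \|\tilde{j}(u)\|_{\widetilde{H}}^2 \geq \mu \|u\|_V^2$ for all $u \in V$. A graph in $H$ is a linear subspace $A$ of $H \times H$. For $\lambda \in \mathbb{C}$, $A + \lambda I := \{(x, y + \lambda x) : (x,y) \in A\}$. A graph $A$ is surjective if for every $y \in H$ there is $x \in H$ with $(x,y) \in A$. A graph $A$ is symmetric if $(x,y)_H \in \mathbb{R}$ for all $(x,y) \in A$. It is self-adjoint if it is symmetric and $A + i s I$ is surjective for all $s \in \mathbb{R} \setminus \{0\}$. The graph associated with $(\mathfrak{a},j)$ is $$A = \{(x,y) \in H \times H : \text{there exists } u \in V \text{ such that } j(u) = x \text{ and } \mathfrak{a}(u,v) = (y,j(v))_H \text{ for all } v \in V\}.$$ *)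

theory Defs
  imports "HOL-Analysis.Analysis"
begin

section \<open>Complex Hilbert spaces\<close>

text \<open>
  The distribution only has real inner product spaces. A complex inner product is added on top of
  \<^class>\<open>real_inner\<close>, whose inner product is its real part; in particular
  the norm and the topology are those of the complex inner product. As everywhere below, forms are
  linear in the first and antilinear in the second argument.
\<close>

class complex_inner = real_inner +
  fixes scaleC :: "complex \<Rightarrow> 'a \<Rightarrow> 'a"  (infixr "*\<^sub>C" 75)
    and cinner :: "'a \<Rightarrow> 'a \<Rightarrow> complex"
  assumes scaleC_add_right: "c *\<^sub>C (x + y) = c *\<^sub>C x + c *\<^sub>C y"
    and scaleC_add_left: "(c + d) *\<^sub>C x = c *\<^sub>C x + d *\<^sub>C x"
    and scaleC_scaleC: "c *\<^sub>C d *\<^sub>C x = (c * d) *\<^sub>C x"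
    and scaleC_of_real: "complex_of_real r *\<^sub>C x = r *\<^sub>R x"
    and cinner_add_left: "cinner (x + y) z = cinner x z + cinner y z"
    and cinner_scaleC_left: "cinner (c *\<^sub>C x) y = c * cinner x y"
    and cinner_commute: "cinner x y = cnj (cinner y x)"
    and Re_cinner: "Re (cinner x y) = inner x y"

class chilbert_space = complex_inner + complete_space

global_interpretation complex_vector:
  vector_space "scaleC :: complex \<Rightarrow> 'a \<Rightarrow> 'a::complex_inner"
proof
  show "1 *\<^sub>C x = x" for x :: 'a
    using scaleC_of_real[of 1 x] by simp
qed (simp_all add: scaleC_add_right scaleC_add_left scaleC_scaleC)

lemma power2_norm_eq_cinner:
  fixes x :: "'a::complex_inner"
  shows "complex_of_real ((norm x)\<^sup>2) = cinner x x"
proof (rule complex_eqI)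
  show "Re (complex_of_real ((norm x)\<^sup>2)) = Re (cinner x x)"
    by (simp add: Re_cinner power2_norm_eq_inner)
  have "Im (cinner x x) = - Im (cinner x x)"
    using arg_cong[OF cinner_commute[of x x], of Im] by simp
  then show "Im (complex_of_real ((norm x)\<^sup>2)) = Im (cinner x x)"
    by simp
qed

instantiation complex :: chilbert_space
begin

definition scaleC_complex :: "complex \<Rightarrow> complex \<Rightarrow> complex"
  where "scaleC_complex c x = c * x"

definition cinner_complex :: "complex \<Rightarrow> complex \<Rightarrow> complex"
  where "cinner_complex x y = x * cnj y"

instance
  by standard (simp_all add: scaleC_complex_def cinner_complex_def inner_complex_def
      scaleR_conv_of_real algebra_simps)

end

instantiation prod :: (complex_inner, complex_inner) complex_inner
begin

definition scaleC_prod :: "complex \<Rightarrow> 'a \<times> 'b \<Rightarrow> 'a \<times> 'b"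
  where "scaleC_prod c p = (c *\<^sub>C fst p, c *\<^sub>C snd p)"

definition cinner_prod :: "'a \<times> 'b \<Rightarrow> 'a \<times> 'b \<Rightarrow> complex"
  where "cinner_prod p q = cinner (fst p) (fst q) + cinner (snd p) (snd q)"

instance
proof
  show "cinner x y = cnj (cinner y x)" for x y :: "'a \<times> 'b"
    unfolding cinner_prod_def complex_cnj_add by (metis cinner_commute)
qed (simp_all add: scaleC_prod_def cinner_prod_def scaleC_add_right scaleC_add_left
      scaleC_scaleC scaleC_of_real cinner_add_left cinner_scaleC_left Re_cinner inner_prod_def
      scaleR_prod_def algebra_simps)

end

instance prod :: (chilbert_space, chilbert_space) chilbert_space ..


section \<open>Bounded and compact operators\<close>

definition bounded_clinear :: "('a::complex_inner \<Rightarrow> 'b::complex_inner) \<Rightarrow> bool"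
  where "bounded_clinear T \<longleftrightarrow>
    Vector_Spaces.linear (*\<^sub>C) (*\<^sub>C) T \<and> (\<exists>K. \<forall>x. norm (T x) \<le> K * norm x)"

definition compact_clinear :: "('a::complex_inner \<Rightarrow> 'b::complex_inner) \<Rightarrow> bool"
  where "compact_clinear T \<longleftrightarrow> bounded_clinear T \<and> compact (closure (T ` cball 0 1))"


section \<open>Sesquilinear forms\<close>

definition sesquilinear_form :: "('v::complex_inner \<Rightarrow> 'v \<Rightarrow> complex) \<Rightarrow> bool"
  where "sesquilinear_form a \<longleftrightarrow>
    (\<forall>u u' v. a (u + u') v = a u v + a u' v) \<and>
    (\<forall>c u v. a (c *\<^sub>C u) v = c * a u v) \<and>
    (\<forall>u v v'. a u (v + v') = a u v + a u v') \<and>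
    (\<forall>c u v. a u (c *\<^sub>C v) = cnj c * a u v)"

definition continuous_form :: "('v::complex_inner \<Rightarrow> 'v \<Rightarrow> complex) \<Rightarrow> bool"
  where "continuous_form a \<longleftrightarrow> continuous_on UNIV (\<lambda>(u, v). a u v)"

definition symmetric_form :: "('v::complex_inner \<Rightarrow> 'v \<Rightarrow> complex) \<Rightarrow> bool"
  where "symmetric_form a \<longleftrightarrow> (\<forall>u v. a u v = cnj (a v u))"

text \<open>
  Since one cannot quantify over types inside a formula, the Hilbert space that is the target
  of the compact operator is an argument of the predicate. When the predicate is a hypothesis
  and the type \<open>'k\<close> is otherwise unconstrained, this amounts to the existence of
  some such Hilbert space.
\<close>

definition compactly_elliptic ::
    "'k::chilbert_space itself \<Rightarrow> ('v::chilbert_space \<Rightarrow> 'v \<Rightarrow> complex) \<Rightarrow> bool"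
  where "compactly_elliptic _ a \<longleftrightarrow>
    (\<exists>(jt :: 'v \<Rightarrow> 'k) (\<omega> :: real) (\<mu> :: real). compact_clinear jt \<and> \<mu> > 0 \<and>
      (\<forall>u. Re (a u u) + \<omega> * (norm (jt u))\<^sup>2 \<ge> \<mu> * (norm u)\<^sup>2))"


section \<open>Graphs\<close>

definition is_graph :: "('h::complex_inner \<times> 'h) set \<Rightarrow> bool"
  where "is_graph A \<longleftrightarrow> complex_vector.subspace A"

definition graph_plus :: "('h::complex_inner \<times> 'h) set \<Rightarrow> complex \<Rightarrow> ('h \<times> 'h) set"
  where "graph_plus A l = {(x, y + l *\<^sub>C x) | x y. (x, y) \<in> A}"

definition surjective_graph :: "('h::complex_inner \<times> 'h) set \<Rightarrow> bool"
  where "surjective_graph A \<longleftrightarrow> (\<forall>y. \<exists>x. (x, y) \<in> A)"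

definition symmetric_graph :: "('h::complex_inner \<times> 'h) set \<Rightarrow> bool"
  where "symmetric_graph A \<longleftrightarrow> (\<forall>(x, y) \<in> A. cinner x y \<in> \<real>)"

definition self_adjoint_graph :: "('h::complex_inner \<times> 'h) set \<Rightarrow> bool"
  where "self_adjoint_graph A \<longleftrightarrow> is_graph A \<and> symmetric_graph A \<and>
    (\<forall>s::real. s \<noteq> 0 \<longrightarrow> surjective_graph (graph_plus A (\<i> * complex_of_real s)))"

definition associated_graph ::
    "('v::complex_inner \<Rightarrow> 'v \<Rightarrow> complex) \<Rightarrow> ('v \<Rightarrow> 'h::complex_inner) \<Rightarrow> ('h \<times> 'h) set"
  where "associated_graph a j =
    {(x, y). \<exists>u. j u = x \<and> (\<forall>v. a u v = cinner y (j v))}"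

end

theory Submission
  imports Defs
begin

text \<open>
  The graph is symmetric because a pair \<open>(x, y)\<close> in it, witnessed by \<open>u\<close>,
  satisfies \<open>(y, x) = a u u\<close>, and the diagonal of a symmetric form is real. The content
  lies in surjectivity: given real \<open>s \<noteq> 0\<close> and \<open>y\<close>, one needs \<open>u\<close> with
  \<open>b u v = (y, j v)\<close> for all \<open>v\<close>, where \<open>b u v = a u v + i s (j u, j v)\<close>.

  The form \<open>b\<close> need not be coercive, nor need the equation be uniquely solvable:
  \<open>b\<close> degenerates on the vectors that \<open>j\<close> kills and that lie in the kernel of
  \<open>a\<close>. Two facts replace the Lax-Milgram lemma.

  \<^item> The operator representing \<open>b\<close> has closed range (\<open>elliptic_closed_range\<close>).
    Compact ellipticity bounds the norm by the operator up to a compact term, so a normalised sequence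
    whose images tend to zero has a limit point, which is in the kernel. Away from the kernel the
    operator is therefore bounded below (\<open>elliptic_bounded_below\<close>).

  \<^item> Hence the equation is solvable as soon as the right-hand side vanishes on every \<open>w\<close>
    with \<open>b u w = 0\<close> for all \<open>u\<close> (\<open>elliptic_form_solvable\<close>). For such a
    \<open>w\<close> in particular \<open>b w w = 0\<close>; since \<open>a w w\<close> is real, its imaginary part
    says that \<open>j w = 0\<close>, so that \<open>(y, j w) = 0\<close>. This is where \<open>s \<noteq> 0\<close>
    enters.

  A form is determined by its real part, as the second argument can be multiplied by \<open>i\<close>. The
  analysis can thus be done with real bilinear forms on real Hilbert spaces, and complex scalars
  only return in the last step.
\<close>

section \<open>Orthogonal projection and Riesz representation in real Hilbert spaces\<close>

text \<open>
  A sequence in \<open>S\<close> that minimises the distance to \<open>x\<close> is Cauchy by the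
  parallelogram law, and minimality of its limit is orthogonality.
\<close>

lemma orthogonal_projection_exists:
  fixes S :: "'a::{real_inner, complete_space} set"
  assumes "subspace S" and "closed S"
  obtains p where "p \<in> S" and "\<And>s. s \<in> S \<Longrightarrow> inner (x - p) s = 0"
proof -
  define D where "D = (\<lambda>s. (norm (x - s))\<^sup>2) ` S"
  define d where "d = Inf D"
  have "0 \<in> S"
    using assms(1) by (rule subspace_0)
  then have ne: "D \<noteq> {}"
    unfolding D_def by blast
  have bdd: "bdd_below D"
    unfolding D_def by (rule bdd_belowI[of _ 0]) auto
  have lower: "d \<le> (norm (x - s))\<^sup>2" if "s \<in> S" for s
    unfolding d_def using that bdd by (intro cInf_lower) (auto simp: D_def)
  have "\<exists>s\<in>S. (norm (x - s))\<^sup>2 < d + 1 / real (Suc n)" for n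
    using cInf_lessD[OF ne, of "d + 1 / real (Suc n)"] unfolding d_def D_def by auto
  then obtain p where pS: "\<And>n. p n \<in> S"
    and p: "\<And>n. (norm (x - p n))\<^sup>2 < d + 1 / real (Suc n)"
    by metis
  have gap: "(norm (p m - p n))\<^sup>2 < 2 / real (Suc m) + 2 / real (Suc n)" for m n
  proof -
    have "(1/2) *\<^sub>R (p m + p n) \<in> S"
      using pS assms(1) by (simp add: subspace_add subspace_scale)
    then have "d \<le> (norm (x - (1/2) *\<^sub>R (p m + p n)))\<^sup>2"
      by (rule lower)
    \<comment> \<open>the parallelogram law for \<open>x - p m\<close> and \<open>x - p n\<close>\<close>
    moreover have "(norm (p m - p n))\<^sup>2 =
        2 * (norm (x - p m))\<^sup>2 + 2 * (norm (x - p n))\<^sup>2 - 4 * (norm (x - (1/2) *\<^sub>R (p m + p n)))\<^sup>2"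
      unfolding power2_norm_eq_inner
      by (simp add: inner_diff_left inner_diff_right inner_add_left inner_add_right
          inner_commute algebra_simps)
    ultimately show ?thesis
      using p[of m] p[of n] by linarith
  qed
  have "Cauchy p"
  proof (rule metric_CauchyI)
    fix e :: real
    assume "e > 0"
    then obtain M where M: "inverse (real (Suc M)) < e\<^sup>2 / 4"
      using reals_Archimedean[of "e\<^sup>2 / 4"] by auto
    have "dist (p m) (p n) < e" if "m \<ge> M" "n \<ge> M" for m n
    proof -
      have "1 / real (Suc m) \<le> 1 / real (Suc M)" "1 / real (Suc n) \<le> 1 / real (Suc M)"
        using that by (auto intro!: divide_left_mono)
      then have "(norm (p m - p n))\<^sup>2 < e\<^sup>2"
        using gap[of m n] M by (simp add: inverse_eq_divide)
      then show ?thesis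
        using \<open>e > 0\<close> by (simp add: dist_norm power2_less_imp_less)
    qed
    then show "\<exists>M. \<forall>m\<ge>M. \<forall>n\<ge>M. dist (p m) (p n) < e"
      by blast
  qed
  then obtain q where q: "p \<longlonglongrightarrow> q"
    by (metis Cauchy_convergent_iff convergent_def)
  have qS: "q \<in> S"
    using assms(2) pS q by (auto intro: closed_sequentially)
  have "(\<lambda>n. (norm (x - p n))\<^sup>2) \<longlonglongrightarrow> (norm (x - q))\<^sup>2"
    by (intro tendsto_intros q)
  moreover have "(\<lambda>n. d + 1 / real (Suc n)) \<longlonglongrightarrow> d + 0"
    by (intro tendsto_intros LIMSEQ_Suc[OF lim_1_over_n])
  ultimately have q_min: "(norm (x - q))\<^sup>2 \<le> d"
    using p by (metis (no_types, lifting) LIMSEQ_le add.right_neutral less_imp_le)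
  have "inner (x - q) s = 0" if "s \<in> S" for s
  proof (cases "s = 0")
    case False
    \<comment> \<open>\<open>q + t s\<close> is the point nearest to \<open>x\<close> on the line through \<open>q\<close> in direction \<open>s\<close>\<close>
    define t where "t = inner (x - q) s / (norm s)\<^sup>2"
    have "q + t *\<^sub>R s \<in> S"
      using qS that assms(1) by (simp add: subspace_add subspace_scale)
    then have "(norm (x - q))\<^sup>2 \<le> (norm (x - (q + t *\<^sub>R s)))\<^sup>2"
      using lower[of "q + t *\<^sub>R s"] q_min by linarith
    also have "\<dots> = (norm (x - q))\<^sup>2 - 2 * t * inner (x - q) s + t\<^sup>2 * (norm s)\<^sup>2"
      unfolding power2_norm_eq_inner
      by (simp add: inner_diff_left inner_diff_right inner_add_left inner_add_right
          inner_commute algebra_simps power2_eq_square)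
    also have "\<dots> = (norm (x - q))\<^sup>2 - (inner (x - q) s)\<^sup>2 / (norm s)\<^sup>2"
      using False by (simp add: t_def field_simps power2_eq_square)
    finally show ?thesis
      using False by (simp add: divide_le_0_iff)
  qed simp
  with qS show thesis
    by (rule that)
qed

text \<open>
  The kernel of a nonzero functional has codimension one, so the functional is a multiple of the inner
  product with any nonzero vector \<open>z\<close> orthogonal to its kernel.
\<close>

lemma riesz_representation:
  fixes f :: "'a::{real_inner, complete_space} \<Rightarrow> real"
  assumes "bounded_linear f"
  obtains g where "\<And>v. f v = inner g v"
proof (cases "\<forall>x. f x = 0")
  case True
  then show thesis
    using that[of 0] by simp
next
  case False
  then obtain x where x: "f x \<noteq> 0"
    by blast
  interpret f: bounded_linear f
    by (rule assms)
  define S where "S = {v. f v = 0}"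
  have "subspace S"
    unfolding S_def subspace_def by (simp add: f.add f.scaleR)
  moreover have "closed S"
    unfolding S_def by (intro closed_Collect_eq continuous_intros f.continuous_on)
  ultimately obtain p where p: "p \<in> S" and orth: "\<And>s. s \<in> S \<Longrightarrow> inner (x - p) s = 0"
    using orthogonal_projection_exists[of S x] by blast
  define z where "z = x - p"
  have fz: "f z = f x"
    using p by (simp add: z_def f.diff S_def)
  then have z: "z \<noteq> 0"
    using x f.zero by auto
  show thesis
  proof (rule that)
    fix v
    \<comment> \<open>the component of \<open>v\<close> in the kernel of \<open>f\<close>\<close>
    have "v - (f v / f z) *\<^sub>R z \<in> S"
      using x fz by (simp add: S_def f.diff f.scaleR)
    then have "inner z (v - (f v / f z) *\<^sub>R z) = 0"
      unfolding z_def by (rule orth)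
    then have "inner z v = f v / f z * inner z z"
      by (simp add: inner_diff_right)
    then show "f v = inner ((f z / inner z z) *\<^sub>R z) v"
      using x fz z by (simp add: field_simps)
  qed
qed

lemma bounded_bilinear_operator:
  fixes b :: "'a::real_normed_vector \<Rightarrow> 'b::{real_inner, complete_space} \<Rightarrow> real"
  assumes "bounded_bilinear b"
  obtains B where "bounded_linear B" and "\<And>u v. b u v = inner (B u) v"
proof -
  interpret b: bounded_bilinear b
    by (rule assms)
  have "\<exists>g. \<forall>v. b u v = inner g v" for u
    using riesz_representation[OF b.bounded_linear_right[of u]] by metis
  then obtain B where B: "\<And>u v. b u v = inner (B u) v"
    by metis
  obtain C where C: "\<And>u v. norm (b u v) \<le> norm u * norm v * C" and "C \<ge> 0"
    using b.nonneg_bounded by blast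
  have "bounded_linear B"
  proof (rule bounded_linear_intro)
    show "B (u + u') = B u + B u'" for u u'
      by (rule vector_eq_rdot[THEN iffD1])
         (metis B b.add_left inner_add_left inner_commute)
    show "B (r *\<^sub>R u) = r *\<^sub>R B u" for r u
      by (rule vector_eq_rdot[THEN iffD1])
         (metis B b.scaleR_left inner_scaleR_left real_scaleR_def inner_commute)
    show "norm (B u) \<le> norm u * C" for u
    proof (cases "B u = 0")
      case False
      have "norm (B u) * norm (B u) \<le> norm (B u) * (norm u * C)"
        using C[of u "B u"] by (simp add: B mult_ac flip: power2_norm_eq_inner power2_eq_square)
      then show ?thesis
        using False by simp
    qed (simp add: \<open>C \<ge> 0\<close>)
  qed
  then show thesis
    using B by (rule that)
qed


section \<open>Operators that are elliptic up to a compact term\<close>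

text \<open>
  Along a subsequence \<open>K u\<close> converges too. Ellipticity, applied to differences of members of the
  subsequence, then bounds these by differences of \<open>B u\<close> and of \<open>K u\<close>, and so the
  subsequence is Cauchy.
\<close>

lemma elliptic_convergent_subsequence:
  fixes B :: "'a::{real_inner, complete_space} \<Rightarrow> 'a" and K :: "'a \<Rightarrow> 'b::real_normed_vector"
  assumes B: "bounded_linear B" and K: "linear K" "compact (closure (K ` cball 0 1))"
    and "\<mu> > 0" and elliptic: "\<And>u. \<mu> * (norm u)\<^sup>2 \<le> inner (B u) u + \<omega> * (norm (K u))\<^sup>2"
    and u: "\<And>n. norm (u n) \<le> 1" "convergent (\<lambda>n. B (u n))"
  obtains r l where "strict_mono (r :: nat \<Rightarrow> nat)" and "(u \<circ> r) \<longlonglongrightarrow> l"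
proof -
  interpret B: bounded_linear B
    by (rule B)
  have "\<forall>n. K (u n) \<in> closure (K ` cball 0 1)"
    using u(1) closure_subset[of "K ` cball 0 1"] by auto
  then obtain k r where r: "strict_mono (r :: nat \<Rightarrow> nat)"
    and k: "((\<lambda>n. K (u n)) \<circ> r) \<longlonglongrightarrow> k"
    using seq_compactE[OF compact_imp_seq_compact[OF K(2)]] by metis
  define w where "w = u \<circ> r"
  have w1: "norm (w n) \<le> 1" for n
    by (simp add: w_def u(1))
  have KC: "Cauchy (\<lambda>n. K (w n))"
    using k by (intro LIMSEQ_imp_Cauchy) (simp add: w_def o_def)
  have BC: "Cauchy (\<lambda>n. B (w n))"
    using LIMSEQ_imp_Cauchy LIMSEQ_subseq_LIMSEQ[OF _ r] u(2)
    unfolding convergent_def w_def o_def by blast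
  have est: "\<mu> * (norm (w m - w n))\<^sup>2
      \<le> 2 * norm (B (w m) - B (w n)) + \<bar>\<omega>\<bar> * (norm (K (w m) - K (w n)))\<^sup>2" for m n
  proof -
    have "inner (B (w m - w n)) (w m - w n) \<le> norm (B (w m - w n)) * norm (w m - w n)"
      by (rule norm_cauchy_schwarz)
    also have "\<dots> \<le> norm (B (w m - w n)) * 2"
      using norm_triangle_ineq4[of "w m" "w n"] w1[of m] w1[of n] by (intro mult_left_mono) auto
    finally have "inner (B (w m - w n)) (w m - w n) \<le> 2 * norm (B (w m) - B (w n))"
      by (simp add: B.diff)
    moreover have "\<omega> * (norm (K (w m - w n)))\<^sup>2 \<le> \<bar>\<omega>\<bar> * (norm (K (w m) - K (w n)))\<^sup>2"
      by (simp add: linear_diff[OF K(1)] mult_right_mono)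
    ultimately show ?thesis
      using elliptic[of "w m - w n"] by linarith
  qed
  have "Cauchy w"
  proof (rule metric_CauchyI)
    fix e :: real
    assume "e > 0"
    \<comment> \<open>If both differences in the estimate above are less than \<open>\<eta>\<close>, its right-hand side is less
      than \<open>(2 + \<bar>\<omega>\<bar>) \<eta>\<close>; as \<open>\<eta> \<le> 1\<close>, the square can be replaced by \<open>\<eta>\<close>.\<close>
    define \<delta> where "\<delta> = \<mu> * e\<^sup>2"
    have "\<delta> > 0"
      using \<open>e > 0\<close> \<open>\<mu> > 0\<close> by (simp add: \<delta>_def)
    define \<eta> where "\<eta> = min 1 (\<delta> / (2 + \<bar>\<omega>\<bar>))"
    have \<eta>: "\<eta> > 0" "\<eta> \<le> 1"
      using \<open>\<delta> > 0\<close> by (auto simp: \<eta>_def intro!: divide_pos_pos)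
    have "\<eta> \<le> \<delta> / (2 + \<bar>\<omega>\<bar>)"
      by (simp add: \<eta>_def)
    then have \<eta>_\<delta>: "(2 + \<bar>\<omega>\<bar>) * \<eta> \<le> \<delta>"
      by (subst (asm) pos_le_divide_eq) (auto simp: mult.commute)
    obtain M1 where M1: "\<And>m n. m \<ge> M1 \<Longrightarrow> n \<ge> M1 \<Longrightarrow> norm (B (w m) - B (w n)) < \<eta>"
      using metric_CauchyD[OF BC \<eta>(1)] by (auto simp: dist_norm)
    obtain M2 where M2: "\<And>m n. m \<ge> M2 \<Longrightarrow> n \<ge> M2 \<Longrightarrow> norm (K (w m) - K (w n)) < \<eta>"
      using metric_CauchyD[OF KC \<eta>(1)] by (auto simp: dist_norm)
    have "dist (w m) (w n) < e" if "m \<ge> max M1 M2" "n \<ge> max M1 M2" for m n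
    proof -
      have 1: "norm (B (w m) - B (w n)) < \<eta>" and 2: "norm (K (w m) - K (w n)) < \<eta>"
        using that M1 M2 by auto
      have "(norm (K (w m) - K (w n)))\<^sup>2 \<le> \<eta> * 1"
        unfolding power2_eq_square using 2 \<eta> by (intro mult_mono) auto
      then have "\<bar>\<omega>\<bar> * (norm (K (w m) - K (w n)))\<^sup>2 \<le> \<bar>\<omega>\<bar> * \<eta>"
        by (simp add: mult_left_mono)
      then have "\<mu> * (norm (w m - w n))\<^sup>2 < (2 + \<bar>\<omega>\<bar>) * \<eta>"
        using est[of m n] 1 \<eta> by (simp add: algebra_simps)
      then have "\<mu> * (norm (w m - w n))\<^sup>2 < \<mu> * e\<^sup>2"
        using \<eta>_\<delta> by (simp add: \<delta>_def)
      then show ?thesis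
        using \<open>\<mu> > 0\<close> \<open>e > 0\<close> by (simp add: dist_norm power2_less_imp_less)
    qed
    then show "\<exists>M. \<forall>m\<ge>M. \<forall>n\<ge>M. dist (w m) (w n) < e"
      by blast
  qed
  then obtain l where "w \<longlonglongrightarrow> l"
    by (metis Cauchy_convergent_iff convergent_def)
  with r show thesis
    by (intro that) (simp_all add: w_def)
qed

text \<open>
  Otherwise there are unit vectors orthogonal to the kernel whose images under \<open>B\<close> tend to zero. A limit point
  of theirs is a unit vector that lies both in the kernel and in its orthogonal complement.
\<close>

lemma elliptic_bounded_below:
  fixes B :: "'a::{real_inner, complete_space} \<Rightarrow> 'a" and K :: "'a \<Rightarrow> 'b::real_normed_vector"
  assumes B: "bounded_linear B" and K: "linear K" "compact (closure (K ` cball 0 1))"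
    and "\<mu> > 0" and elliptic: "\<And>u. \<mu> * (norm u)\<^sup>2 \<le> inner (B u) u + \<omega> * (norm (K u))\<^sup>2"
  obtains c where "c > 0"
    and "\<And>u. (\<And>n. B n = 0 \<Longrightarrow> inner u n = 0) \<Longrightarrow> c * norm u \<le> norm (B u)"
proof -
  interpret B: bounded_linear B
    by (rule B)
  let ?P = "\<lambda>u. \<forall>n. B n = 0 \<longrightarrow> inner u n = 0"
  have "\<exists>c>0. \<forall>u. ?P u \<longrightarrow> c * norm u \<le> norm (B u)"
  proof (rule ccontr)
    assume neg: "\<not> ?thesis"
    have "\<exists>w. ?P w \<and> norm w = 1 \<and> norm (B w) < 1 / real (Suc k)" for k
    proof -
      obtain u where P: "?P u" and u: "norm (B u) < 1 / real (Suc k) * norm u"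
        using neg by (metis not_le of_nat_0_less_iff zero_less_Suc zero_less_divide_1_iff)
      have "norm u > 0"
        using u by (cases "u = 0") auto
      then show ?thesis
        using P u by (intro exI[of _ "u /\<^sub>R norm u"]) (auto simp: B.scaleR field_simps)
    qed
    then obtain w where P: "\<And>k. ?P (w k)" and w1: "\<And>k. norm (w k) = 1"
      and Bw: "\<And>k. norm (B (w k)) < 1 / real (Suc k)"
      by metis
    have Bw0: "(\<lambda>k. B (w k)) \<longlonglongrightarrow> 0"
      by (rule Lim_null_comparison[OF _ LIMSEQ_Suc[OF lim_1_over_n]])
         (simp add: Bw less_imp_le del: of_nat_Suc)
    then have "convergent (\<lambda>k. B (w k))"
      by (rule convergentI)
    then obtain r l where r: "strict_mono (r :: nat \<Rightarrow> nat)" and l: "(w \<circ> r) \<longlonglongrightarrow> l"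
      using elliptic_convergent_subsequence[OF B K \<open>\<mu> > 0\<close> elliptic, where u = w] w1
      by (metis order_refl)
    have "(\<lambda>k. B ((w \<circ> r) k)) \<longlonglongrightarrow> B l"
      by (rule B.tendsto[OF l])
    moreover have "(\<lambda>k. B ((w \<circ> r) k)) \<longlonglongrightarrow> 0"
      using LIMSEQ_subseq_LIMSEQ[OF Bw0 r] by (simp add: o_def)
    ultimately have "B l = 0"
      by (rule LIMSEQ_unique)
    then have "inner ((w \<circ> r) k) l = 0" for k
      using P by simp
    moreover have "(\<lambda>k. inner ((w \<circ> r) k) l) \<longlonglongrightarrow> inner l l"
      by (intro tendsto_intros l)
    ultimately have "l = 0"
      by (simp add: LIMSEQ_const_iff)
    moreover have "(\<lambda>k. norm ((w \<circ> r) k)) \<longlonglongrightarrow> norm l"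
      by (intro tendsto_intros l)
    ultimately show False
      by (simp add: w1 LIMSEQ_const_iff)
  qed
  then show thesis
    using that by blast
qed

text \<open>
  A convergent sequence in the range has preimages orthogonal to the kernel; these are Cauchy because
  \<open>B\<close> is bounded below there.
\<close>

lemma elliptic_closed_range:
  fixes B :: "'a::{real_inner, complete_space} \<Rightarrow> 'a" and K :: "'a \<Rightarrow> 'b::real_normed_vector"
  assumes B: "bounded_linear B" and K: "linear K" "compact (closure (K ` cball 0 1))"
    and "\<mu> > 0" and elliptic: "\<And>u. \<mu> * (norm u)\<^sup>2 \<le> inner (B u) u + \<omega> * (norm (K u))\<^sup>2"
  shows "closed (range B)"
proof -
  interpret B: bounded_linear B
    by (rule B)
  define N where "N = {u. B u = 0}"
  obtain c where "c > 0"
    and c: "\<And>u. (\<And>n. B n = 0 \<Longrightarrow> inner u n = 0) \<Longrightarrow> c * norm u \<le> norm (B u)"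
    using elliptic_bounded_below[OF assms] by blast
  have N: "subspace N" "closed N"
    unfolding N_def subspace_def
    by (simp_all add: B.add B.scaleR closed_Collect_eq B.continuous_on)
  have lift: "\<exists>u. B u = z \<and> (\<forall>n\<in>N. inner u n = 0)" if "z \<in> range B" for z
  proof -
    obtain u where "z = B u"
      using \<open>z \<in> range B\<close> by blast
    obtain p where "p \<in> N" "\<And>n. n \<in> N \<Longrightarrow> inner (u - p) n = 0"
      using orthogonal_projection_exists[OF N, of u] by blast
    then show ?thesis
      using \<open>z = B u\<close> by (intro exI[of _ "u - p"]) (simp add: B.diff N_def)
  qed
  show ?thesis
    unfolding closed_sequential_limits
  proof (intro allI impI, elim conjE)
    fix z y
    assume "\<forall>n. z n \<in> range B" and z: "z \<longlonglongrightarrow> y"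
    then have "\<forall>n. \<exists>u. B u = z n \<and> (\<forall>k\<in>N. inner u k = 0)"
      using lift by blast
    from choice[OF this] obtain u where u: "\<And>n. B (u n) = z n"
      and orth: "\<And>n k. k \<in> N \<Longrightarrow> inner (u n) k = 0"
      by blast
    have bound: "c * norm (u m - u n) \<le> norm (z m - z n)" for m n
      using c[of "u m - u n"] orth by (simp add: inner_diff_left N_def B.diff u)
    have "Cauchy u"
    proof (rule metric_CauchyI)
      fix e :: real
      assume "e > 0"
      then obtain M where M: "\<And>m n. m \<ge> M \<Longrightarrow> n \<ge> M \<Longrightarrow> norm (z m - z n) < c * e"
        using metric_CauchyD[OF LIMSEQ_imp_Cauchy[OF z], of "c * e"] \<open>c > 0\<close>
        by (auto simp: dist_norm)
      have "dist (u m) (u n) < e" if "m \<ge> M" "n \<ge> M" for m n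
      proof -
        have "c * norm (u m - u n) < c * e"
          using bound[of m n] M[OF that] by linarith
        then show ?thesis
          using \<open>c > 0\<close> by (simp add: dist_norm)
      qed
      then show "\<exists>M. \<forall>m\<ge>M. \<forall>n\<ge>M. dist (u m) (u n) < e"
        by blast
    qed
    then obtain l where "u \<longlonglongrightarrow> l"
      by (metis Cauchy_convergent_iff convergent_def)
    then have "(\<lambda>n. B (u n)) \<longlonglongrightarrow> B l"
      by (rule B.tendsto)
    then have "y = B l"
      using z by (auto simp: u intro: LIMSEQ_unique)
    then show "y \<in> range B"
      by blast
  qed
qed

text \<open>
  A Fredholm alternative: the obstruction to solving \<open>b u v = f v\<close> is the part \<open>w\<close> of the
  Riesz vector of \<open>f\<close> that is orthogonal to the closed range of the operator of \<open>b\<close>. It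
  satisfies \<open>b u w = 0\<close> for all \<open>u\<close>, hence \<open>f w = 0\<close>, which says that
  \<open>w\<close> is orthogonal to itself.
\<close>

lemma elliptic_form_solvable:
  fixes b :: "'a::{real_inner, complete_space} \<Rightarrow> 'a \<Rightarrow> real"
    and K :: "'a \<Rightarrow> 'b::real_normed_vector"
  assumes b: "bounded_bilinear b" and K: "linear K" "compact (closure (K ` cball 0 1))"
    and "\<mu> > 0" and elliptic: "\<And>u. \<mu> * (norm u)\<^sup>2 \<le> b u u + \<omega> * (norm (K u))\<^sup>2"
    and f: "bounded_linear f" "\<And>w. (\<And>u. b u w = 0) \<Longrightarrow> f w = 0"
  obtains u where "\<And>v. b u v = f v"
proof -
  obtain B where B: "bounded_linear B" and b_eq: "\<And>u v. b u v = inner (B u) v"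
    using bounded_bilinear_operator[OF b] by blast
  obtain g where g: "\<And>v. f v = inner g v"
    using riesz_representation[OF f(1)] by blast
  have "closed (range B)"
    using elliptic unfolding b_eq by (rule elliptic_closed_range[OF B K \<open>\<mu> > 0\<close>])
  moreover have "subspace (range B)"
    by (intro linear_subspace_image bounded_linear.linear[OF B] subspace_UNIV)
  ultimately obtain p where p: "p \<in> range B"
    and orth: "\<And>s. s \<in> range B \<Longrightarrow> inner (g - p) s = 0"
    using orthogonal_projection_exists by blast
  define w where "w = g - p"
  have "b u w = 0" for u
    using orth[of "B u"] by (simp add: b_eq w_def inner_commute)
  then have "inner g w = 0"
    using f(2) g by simp
  moreover have "inner w p = 0"
    using orth[OF p] by (simp add: w_def)
  ultimately have "inner w w = 0"
    by (simp add: w_def inner_diff_left inner_diff_right inner_commute)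
  then have "g = p"
    by (simp add: w_def)
  then obtain u where "g = B u"
    using p by blast
  then show thesis
    by (intro that[of u]) (simp add: b_eq g)
qed


section \<open>Complex inner products and sesquilinear forms\<close>

lemma cinner_add_right: "cinner x (y + z) = cinner x y + cinner x z"
  by (metis cinner_add_left cinner_commute complex_cnj_add)

lemma cinner_scaleC_right: "cinner x (c *\<^sub>C y) = cnj c * cinner x y"
  by (metis cinner_scaleC_left cinner_commute complex_cnj_mult)

lemma cinner_diff_left: "cinner (x - y) z = cinner x z - cinner y z"
  by (metis add_diff_cancel_right' cinner_add_left diff_add_cancel)

lemma norm_scaleC: "norm (c *\<^sub>C x) = cmod c * norm x"
proof (rule power2_eq_imp_eq)
  have "complex_of_real ((norm (c *\<^sub>C x))\<^sup>2) = cnj c * c * complex_of_real ((norm x)\<^sup>2)"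
    by (simp only: power2_norm_eq_cinner cinner_scaleC_left cinner_scaleC_right mult.assoc)
  also have "\<dots> = complex_of_real ((cmod c * norm x)\<^sup>2)"
    by (simp only: mult.commute[of "cnj c"] complex_norm_square[symmetric] power_mult_distrib
        of_real_mult of_real_power)
  finally show "(norm (c *\<^sub>C x))\<^sup>2 = (cmod c * norm x)\<^sup>2"
    by (simp only: of_real_eq_iff)
qed auto

lemma bounded_linear_scaleC: "bounded_linear (\<lambda>x::'a::complex_inner. c *\<^sub>C x)"
  by (rule bounded_linear_intro[of _ "cmod c"])
     (simp_all add: scaleC_add_right norm_scaleC scaleC_scaleC mult.commute flip: scaleC_of_real)

lemma continuous_on_cinner:
  fixes f g :: "'b::topological_space \<Rightarrow> 'a::complex_inner"
  assumes "continuous_on S f" and "continuous_on S g"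
  shows "continuous_on S (\<lambda>x. cinner (f x) (g x))"
proof -
  \<comment> \<open>The imaginary part of the inner product is a real inner product with a rotated vector.\<close>
  have "cinner x z = Complex (inner x z) (inner x (\<i> *\<^sub>C z))" for x z :: 'a
    by (rule complex_eqI) (simp_all add: cinner_scaleC_right flip: Re_cinner)
  then show ?thesis
    using assms by (simp add: Complex_eq)
      (intro continuous_intros bounded_linear.continuous_on[OF bounded_linear_scaleC])
qed

lemma sesquilinear_form_zero:
  assumes "sesquilinear_form a"
  shows "a 0 v = 0" and "a u 0 = 0"
  using assms unfolding sesquilinear_form_def by (metis add_cancel_right_right)+

lemma sesquilinear_form_scaleR:
  assumes "sesquilinear_form a"
  shows "a (r *\<^sub>R u) v = of_real r * a u v" and "a u (r *\<^sub>R v) = of_real r * a u v"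
  using assms unfolding sesquilinear_form_def
  by (metis scaleC_of_real complex_cnj_complex_of_real)+

text \<open>
  Continuity at the origin bounds the form by one on a product of two small balls; scaling the
  arguments into it gives the global bound.
\<close>

lemma continuous_form_bounded:
  assumes a: "sesquilinear_form a" and "continuous_form a"
  obtains C where "\<And>u v. norm (a u v) \<le> norm u * norm v * C"
proof -
  have "isCont (\<lambda>(u, v). a u v) (0, 0)"
    using assms(2) unfolding continuous_form_def by (simp add: continuous_on_eq_continuous_at)
  then obtain d where "d > 0"
    and d: "\<And>p. dist p (0, 0) < d \<Longrightarrow> dist ((\<lambda>(u, v). a u v) p) (a 0 0) < 1"
    unfolding continuous_at_eps_delta by (metis (no_types, lifting) case_prod_conv zero_less_one)
  \<comment> \<open>any fraction below one half, so that \<open>\<delta> + \<delta> < d\<close>\<close>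
  define \<delta> where "\<delta> = d / 3"
  have "\<delta> > 0"
    using \<open>d > 0\<close> by (simp add: \<delta>_def)
  have small: "norm (a u v) \<le> 1" if "norm u \<le> \<delta>" "norm v \<le> \<delta>" for u v
  proof -
    have "dist (u, v) (0, 0) \<le> norm u + norm v"
      by (simp add: dist_Pair_Pair sqrt_sum_squares_le_sum)
    also have "\<dots> < d"
      using that \<open>d > 0\<close> by (simp add: \<delta>_def)
    finally show ?thesis
      using d[of "(u, v)"] sesquilinear_form_zero[OF a] by simp
  qed
  show thesis
  proof (rule that[of "1 / \<delta>\<^sup>2"])
    fix u v
    show "norm (a u v) \<le> norm u * norm v * (1 / \<delta>\<^sup>2)"
    proof (cases "u = 0 \<or> v = 0")
      case True
      then show ?thesis
        using sesquilinear_form_zero[OF a] by auto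
    next
      case False
      have "norm (a ((\<delta> / norm u) *\<^sub>R u) ((\<delta> / norm v) *\<^sub>R v)) \<le> 1"
        using False \<open>\<delta> > 0\<close> by (intro small) auto
      then have "\<delta>\<^sup>2 * norm (a u v) / (norm u * norm v) \<le> 1"
        using \<open>\<delta> > 0\<close>
        by (simp add: sesquilinear_form_scaleR[OF a] norm_mult norm_divide power2_eq_square mult_ac)
      then have "\<delta>\<^sup>2 * norm (a u v) \<le> norm u * norm v"
        using False by (simp add: pos_divide_le_eq)
      then show ?thesis
        using False \<open>\<delta> > 0\<close> by (simp add: pos_le_divide_eq mult.commute)
    qed
  qed
qed

lemma bounded_bilinear_Re_form:
  assumes a: "sesquilinear_form a" and "continuous_form a"
  shows "bounded_bilinear (\<lambda>u v. Re (a u v))"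
proof -
  obtain C where C: "\<And>u v. norm (a u v) \<le> norm u * norm v * C"
    using continuous_form_bounded[OF assms] by blast
  show ?thesis
  proof
    show "\<exists>K. \<forall>u v. norm (Re (a u v)) \<le> norm u * norm v * K"
      using C abs_Re_le_cmod order_trans unfolding real_norm_def by blast
  qed (use a in \<open>simp_all add: sesquilinear_form_def sesquilinear_form_scaleR[OF a]\<close>)
qed

lemma bounded_clinear_simps:
  assumes "bounded_clinear T"
  shows "T (x + y) = T x + T y" and "T (c *\<^sub>C x) = c *\<^sub>C T x"
  using assms unfolding bounded_clinear_def
  by (auto simp: Vector_Spaces.linear_iff)

lemma bounded_clinear_bounded_linear:
  assumes "bounded_clinear T"
  shows "bounded_linear T"
proof -
  obtain K where "\<And>x. norm (T x) \<le> K * norm x"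
    using assms unfolding bounded_clinear_def by blast
  then show ?thesis
    by (intro bounded_linear_intro[of _ K])
       (simp_all add: bounded_clinear_simps[OF assms] mult.commute flip: scaleC_of_real)
qed


section \<open>The associated graph\<close>

lemma is_graph_associated_graph:
  assumes a: "sesquilinear_form a" and j: "bounded_clinear j"
  shows "is_graph (associated_graph a j)"
proof -
  interpret j: bounded_linear j
    using j by (rule bounded_clinear_bounded_linear)
  have "0 \<in> associated_graph a j"
    unfolding associated_graph_def zero_prod_def
    by (auto intro!: exI[of _ 0] simp: j.zero sesquilinear_form_zero[OF a])
       (metis add_cancel_right_right cinner_add_left)
  moreover have "p + q \<in> associated_graph a j"
    if "p \<in> associated_graph a j" "q \<in> associated_graph a j" for p q
  proof -
    obtain u w where "j u = fst p" "\<And>v. a u v = cinner (snd p) (j v)"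
      "j w = fst q" "\<And>v. a w v = cinner (snd q) (j v)"
      using \<open>p \<in> _\<close> \<open>q \<in> _\<close> unfolding associated_graph_def by auto
    then show ?thesis
      using a unfolding associated_graph_def sesquilinear_form_def
      by (auto intro!: exI[of _ "u + w"] simp: j.add cinner_add_left plus_prod_def)
  qed
  moreover have "c *\<^sub>C p \<in> associated_graph a j" if p: "p \<in> associated_graph a j" for c p
  proof -
    obtain u where "j u = fst p" "\<And>v. a u v = cinner (snd p) (j v)"
      using p unfolding associated_graph_def by auto
    then show ?thesis
      using a unfolding associated_graph_def sesquilinear_form_def
      by (auto intro!: exI[of _ "c *\<^sub>C u"]
          simp: bounded_clinear_simps[OF j] cinner_scaleC_left scaleC_prod_def)
  qed
  ultimately show ?thesis
    unfolding is_graph_def complex_vector.subspace_def by blast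
qed

lemma symmetric_associated_graph:
  assumes "symmetric_form a"
  shows "symmetric_graph (associated_graph a j)"
  unfolding symmetric_graph_def
proof (clarify)
  fix x y
  assume "(x, y) \<in> associated_graph a j"
  then obtain u where u: "j u = x" "a u u = cinner y x"
    unfolding associated_graph_def by blast
  have "a u u = cnj (a u u)"
    using assms unfolding symmetric_form_def by blast
  then show "cinner x y \<in> \<real>"
    using u cinner_commute[of x y] by (metis Reals_cnj_iff)
qed

text \<open>
  The shift adds \<open>i s (j u, j v)\<close> to the form. This is purely imaginary on the diagonal, so it
  leaves the ellipticity estimate intact, while its imaginary part forces \<open>j w = 0\<close> for each
  \<open>w\<close> that obstructs solvability.
\<close>

lemma surjective_associated_graph_shift:
  fixes a :: "'v::chilbert_space \<Rightarrow> 'v \<Rightarrow> complex"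
    and j :: "'v \<Rightarrow> 'h::chilbert_space"
  assumes a: "sesquilinear_form a" "continuous_form a" "symmetric_form a"
    and j: "bounded_clinear j"
    and elliptic: "compactly_elliptic TYPE('k::chilbert_space) a"
    and "s \<noteq> 0"
  shows "surjective_graph (graph_plus (associated_graph a j) (\<i> * complex_of_real s))"
  unfolding surjective_graph_def
proof
  fix y :: 'h
  interpret j: bounded_linear j
    using j by (rule bounded_clinear_bounded_linear)
  obtain K :: "'v \<Rightarrow> 'k" and \<omega> \<mu> where K: "compact_clinear K" and "\<mu> > 0"
    and ell: "\<And>u. Re (a u u) + \<omega> * (norm (K u))\<^sup>2 \<ge> \<mu> * (norm u)\<^sup>2"
    using elliptic unfolding compactly_elliptic_def by blast
  have linK: "linear K"
    using K bounded_linear.linear[OF bounded_clinear_bounded_linear]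
    unfolding compact_clinear_def by blast
  define \<sigma> where "\<sigma> = \<i> * complex_of_real s"
  define b where "b u v = a u v + \<sigma> * cinner (j u) (j v)" for u v
  have b_sesq: "sesquilinear_form b"
    using a(1) unfolding sesquilinear_form_def b_def
    by (simp add: bounded_clinear_simps[OF j] cinner_add_left cinner_add_right
        cinner_scaleC_left cinner_scaleC_right algebra_simps)
  have "continuous_form b"
    using a(2) unfolding continuous_form_def b_def case_prod_beta
    by (intro continuous_intros continuous_on_cinner j.continuous_on) auto
  then have b_bilinear: "bounded_bilinear (\<lambda>u v. Re (b u v))"
    by (rule bounded_bilinear_Re_form[OF b_sesq])
  have diag: "a u u \<in> \<real>" for u
    using a(3) unfolding symmetric_form_def by (metis Reals_cnj_iff)
  have b_diag: "b u u = of_real (Re (a u u)) + \<i> * of_real (s * (norm (j u))\<^sup>2)" for u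
    using diag[of u] power2_norm_eq_cinner[of "j u"] by (simp add: b_def \<sigma>_def)
  define f where "f v = Re (cinner y (j v))" for v
  have "bounded_linear f"
    unfolding f_def Re_cinner
    by (intro bounded_linear_compose[OF bounded_linear_inner_right] j.bounded_linear_axioms)
  have vanish: "f w = 0" if "\<And>u. Re (b u w) = 0" for w
  proof -
    \<comment> \<open>testing with \<open>i w\<close> extracts the imaginary part of \<open>b w w\<close>\<close>
    have "b (\<i> *\<^sub>C w) w = \<i> * b w w"
      using b_sesq unfolding sesquilinear_form_def by blast
    then have "Im (b w w) = 0"
      using that[of "\<i> *\<^sub>C w"] by simp
    then have "j w = 0"
      using \<open>s \<noteq> 0\<close> by (simp add: b_diag)
    then show ?thesis
      by (simp add: f_def Re_cinner)
  qed
  obtain u where u: "\<And>v. Re (b u v) = f v"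
  proof (rule elliptic_form_solvable[OF b_bilinear linK _ \<open>\<mu> > 0\<close> _ \<open>bounded_linear f\<close>])
    show "compact (closure (K ` cball 0 1))"
      using K unfolding compact_clinear_def by blast
    show "\<mu> * (norm u)\<^sup>2 \<le> Re (b u u) + \<omega> * (norm (K u))\<^sup>2" for u
      using ell[of u] by (simp add: b_diag)
  qed (use vanish in auto)
  have "b u v = cinner y (j v)" for v
  proof (rule complex_eqI)
    show "Re (b u v) = Re (cinner y (j v))"
      by (simp add: u f_def)
    \<comment> \<open>the imaginary parts agree because the real parts agree at \<open>i v\<close>\<close>
    have "b u (\<i> *\<^sub>C v) = - \<i> * b u v"
      using b_sesq unfolding sesquilinear_form_def by simp
    then show "Im (b u v) = Im (cinner y (j v))"
      using u[of "\<i> *\<^sub>C v"]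
      by (simp add: f_def bounded_clinear_simps[OF j] cinner_scaleC_right)
  qed
  then have "a u v = cinner (y - \<sigma> *\<^sub>C j u) (j v)" for v
    unfolding b_def
    by (metis add_diff_cancel_right' cinner_diff_left cinner_scaleC_left)
  then have "(j u, y - \<sigma> *\<^sub>C j u) \<in> associated_graph a j"
    unfolding associated_graph_def by auto
  then have "(j u, y) \<in> graph_plus (associated_graph a j) \<sigma>"
    unfolding graph_plus_def by force
  then show "\<exists>x. (x, y) \<in> graph_plus (associated_graph a j) (\<i> * complex_of_real s)"
    unfolding \<sigma>_def by blast
qed

theorem theorem4p5:
  fixes a :: "'v::chilbert_space \<Rightarrow> 'v \<Rightarrow> complex"
    and j :: "'v \<Rightarrow> 'h::chilbert_space"
    and A :: "('h \<times> 'h) set"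
  assumes "sesquilinear_form a" and "continuous_form a" and "symmetric_form a"
    and "bounded_clinear j"
    and "A = associated_graph a j"
    and "compactly_elliptic TYPE('k::chilbert_space) a"
  shows "self_adjoint_graph A"
  unfolding self_adjoint_graph_def \<open>A = associated_graph a j\<close>
  using assms is_graph_associated_graph symmetric_associated_graph
    surjective_associated_graph_shift by blast

end
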